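(* Let $1\le\delta<\Delta$ be integers, $\tilde h:\mathbb{Z}^+\to\mathbb{R}^+$ a positive non-increasing function and $\mathcal{J}(G)=\sum_{u\in V(G)}\tilde h(d_u)$. Then $H_{\delta,\Delta}$ is minimal for $\mathcal{J}$ on $\mathfrak{G}^{\Delta+1}_{\delta,\Delta}$, i.e. $\mathcal{J}(H_{\delta,\Delta})\le\mathcal{J}(G)$ for all $G\in\mathfrak{G}^{\Delta+1}_{\delta,\Delta}$. Moreover, if $\tilde h(\Delta-2)>\tilde h(\Delta-1)>\tilde h(\Delta)$, then $G\in\mathfrak{G}^{\Delta+1}_{\delta,\Delta}$ is minimal for $\mathcal{J}$ on $\mathfrak{G}^{\Delta+1}_{\delta,\Delta}$ if and only if $G$ is (isomorphic to) $H_{\delta,\Delta}$.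
   Context: All graphs are finite and simple; $d_u$ is the degree of $u$. $\mathfrak{G}^n_{\delta,\Delta}$ is the family of graphs with $n$ vertices, minimum degree $\delta$ and maximum degree $\Delta$. $H_{\delta,\Delta}$ is the graph obtained from a complete graph on vertices $v_1,\dots,v_\Delta$ by adding a vertex $w$ and the edges $v_iw$ for $1\le i\le\delta$. A graph $G$ in a family $\mathcal{F}$ is minimal for $\mathcal{J}$ on $\mathcal{F}$ if $\mathcal{J}(G)\le\mathcal{J}(\Gamma)$ for all $\Gamma\in\mathcal{F}$. *)

theory Defs
  imports Complex_Main "Graph_Theory.Pair_Digraph" "Graph_Theory.Digraph_Isomorphism"
begin

text \<open>
  A finite simple graph is a \<^locale>\<open>pair_graph\<close>: a finite, symmetric, loop-free digraph without
  parallel arcs. An undirected edge \<open>uv\<close> is the pair of arcs \<open>(u, v)\<close>, \<open>(v, u)\<close>, so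
  the degree of a vertex \<open>u\<close> is \<open>out_degree G u\<close>.
\<close>

definition graph_family :: "nat \<Rightarrow> nat \<Rightarrow> nat \<Rightarrow> 'a pair_pre_digraph set" where
  "graph_family n \<delta> \<Delta> =
     {G. pair_graph G \<and> card (pverts G) = n \<and>
         Min (out_degree (with_proj G) ` pverts G) = \<delta> \<and>
         Max (out_degree (with_proj G) ` pverts G) = \<Delta>}"

definition degree_index :: "(nat \<Rightarrow> real) \<Rightarrow> 'a pair_pre_digraph \<Rightarrow> real" where
  "degree_index h G = (\<Sum>u\<in>pverts G. h (out_degree (with_proj G) u))"

text \<open>The vertex \<open>v\<^sub>i\<close> is the number \<open>i\<close>, and \<open>w\<close> is \<open>0\<close>.\<close>

definition H_graph :: "nat \<Rightarrow> nat \<Rightarrow> nat pair_pre_digraph" where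
  "H_graph \<delta> \<Delta> =
     \<lparr> pverts = {1..\<Delta>} \<union> {0},
       parcs = {(i, j). i \<in> {1..\<Delta>} \<and> j \<in> {1..\<Delta>} \<and> i \<noteq> j} \<union> {1..\<delta>} \<times> {0} \<union> {0} \<times> {1..\<delta>} \<rparr>"

text \<open>
  The competitors \<open>\<Gamma>\<close> share the vertex type of \<open>G\<close>. For a family of graphs on \<open>n\<close> vertices that is
  closed under isomorphism this is no restriction: if \<open>G\<close> is a member, its vertex type has at least
  \<open>n\<close> elements, so it carries a copy of every graph on \<open>n\<close> vertices.
\<close>

definition minimal_on ::
    "('a pair_pre_digraph \<Rightarrow> real) \<Rightarrow> 'a pair_pre_digraph set \<Rightarrow> 'a pair_pre_digraph \<Rightarrow> bool" where
  "minimal_on J F G \<longleftrightarrow> G \<in> F \<and> (\<forall>\<Gamma>\<in>F. J G \<le> J \<Gamma>)"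

end

theory Submission
  imports Defs
begin

text \<open>
  Fix a vertex \<open>w\<close> of minimum degree \<open>\<delta>\<close> and add every missing edge that avoids \<open>w\<close>. This raises
  degrees and keeps the degree of \<open>w\<close>, so it can only decrease the index, and the result is a copy
  of \<open>H_graph \<delta> \<Delta>\<close>: \<open>\<delta>\<close> vertices have degree \<open>\<Delta>\<close>, the other ones different from \<open>w\<close> have degree
  \<open>\<Delta> - 1\<close>. If \<open>h (\<Delta> - 2) > h (\<Delta> - 1) > h \<Delta>\<close>, the decrease is strict unless no edge is missing,
  because saturation raises every degree that it changes to \<open>\<Delta> - 1\<close> or \<open>\<Delta>\<close>.
\<close>

text \<open>The largest neighbourhood of a vertex \<open>u\<close> in a graph on the same vertices
  in which \<open>w\<close> keeps exactly its neighbours from \<open>G\<close>.\<close>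

definition max_nbhd :: "'a pair_pre_digraph \<Rightarrow> 'a \<Rightarrow> 'a \<Rightarrow> 'a set" where
  "max_nbhd G w u =
     (if u = w then parcs G `` {w} else if (w, u) \<in> parcs G then pverts G - {u} else pverts G - {u, w})"

definition saturate :: "'a pair_pre_digraph \<Rightarrow> 'a \<Rightarrow> 'a pair_pre_digraph" where
  "saturate G w = \<lparr>pverts = pverts G, parcs = Sigma (pverts G) (max_nbhd G w)\<rparr>"

lemma pverts_saturate [simp]: "pverts (saturate G w) = pverts G"
  by (simp add: saturate_def)

section \<open>Degrees as sizes of neighbourhoods\<close>

lemma out_degree_with_proj: "out_degree (with_proj G) u = card (parcs G `` {u})"
proof -
  have "out_arcs (with_proj G) u = Pair u ` (parcs G `` {u})"
    by (auto simp: out_arcs_def)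
  then show ?thesis
    by (simp add: out_degree_def card_image inj_on_def)
qed

lemma degree_index_nbhd: "degree_index h G = (\<Sum>u\<in>pverts G. h (card (parcs G `` {u})))"
  by (simp add: degree_index_def out_degree_with_proj)

lemma pair_graph_iff:
  "pair_graph G \<longleftrightarrow> finite (pverts G) \<and> parcs G \<subseteq> pverts G \<times> pverts G \<and> sym (parcs G) \<and> irrefl (parcs G)"
proof
  assume "pair_graph G"
  then interpret pair_graph G .
  have "parcs G \<subseteq> pverts G \<times> pverts G"
    by (rule subsetI) (simp add: mem_Times_iff arc_fst_in_verts arc_snd_in_verts)
  moreover have "irrefl (parcs G)"
    using pair_no_loops by (force simp: irrefl_def)
  moreover have "sym (parcs G)"
    by (auto simp: sym_def intro: arcs_symmetric)
  ultimately show "finite (pverts G) \<and> parcs G \<subseteq> pverts G \<times> pverts G \<and> sym (parcs G) \<and> irrefl (parcs G)"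
    using pair_finite_verts by blast
next
  assume *: "finite (pverts G) \<and> parcs G \<subseteq> pverts G \<times> pverts G \<and> sym (parcs G) \<and> irrefl (parcs G)"
  then have "finite (parcs G)"
    by (meson finite_SigmaI finite_subset)
  with * show "pair_graph G"
    by unfold_locales (auto simp: symmetric_def irrefl_def)
qed

section \<open>Saturation at a vertex\<close>

context pair_graph
begin

lemma nbhd_subset: "parcs G `` {u} \<subseteq> pverts G - {u}"
  using pair_graph_axioms by (auto simp: pair_graph_iff irrefl_def)

text \<open>If \<open>u\<close> is not adjacent from \<open>w\<close>, an arc from \<open>u\<close>
  to \<open>w\<close> is excluded by symmetry, so leaving out \<open>w\<close> loses
  nothing.\<close>

lemma nbhd_subset_max_nbhd: "parcs G `` {u} \<subseteq> max_nbhd G w u"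
  using nbhd_subset[of u] by (auto simp: max_nbhd_def dest: arcs_symmetric)

lemma max_nbhd_subset: "max_nbhd G w u \<subseteq> pverts G - {u}"
  using nbhd_subset[of u] by (auto simp: max_nbhd_def)

lemma finite_max_nbhd: "finite (max_nbhd G w u)"
  using finite_subset[OF max_nbhd_subset] pair_finite_verts by blast

lemma nbhd_saturate: "u \<in> pverts G \<Longrightarrow> parcs (saturate G w) `` {u} = max_nbhd G w u"
  by (auto simp: saturate_def)

lemma pair_graph_saturate:
  assumes "w \<in> pverts G"
  shows "pair_graph (saturate G w)"
  unfolding pair_graph_iff
proof (intro conjI)
  show "finite (pverts (saturate G w))"
    by (simp add: pair_finite_verts)
  show "parcs (saturate G w) \<subseteq> pverts (saturate G w) \<times> pverts (saturate G w)"
    using max_nbhd_subset by (fastforce simp: saturate_def)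
  show "irrefl (parcs (saturate G w))"
    using max_nbhd_subset by (fastforce simp: saturate_def irrefl_def)
  \<comment> \<open>If one of \<open>u\<close>, \<open>v\<close> is \<open>w\<close>, both
    memberships say that the other is a neighbour of \<open>w\<close> in \<open>G\<close>; otherwise
    both say that the two vertices differ.\<close>
  have "u \<in> max_nbhd G w v" if "v \<in> max_nbhd G w u" "u \<in> pverts G" for u v
    using that assms nbhd_subset[of u] nbhd_subset[of v] nbhd_subset[of w]
    by (auto simp: max_nbhd_def split: if_splits dest: arcs_symmetric)
  then show "sym (parcs (saturate G w))"
    using max_nbhd_subset by (fastforce simp: saturate_def sym_def)
qed

lemma card_max_nbhd:
  assumes "w \<in> pverts G" "u \<in> pverts G"
  shows "card (max_nbhd G w u) =
    (if u = w then card (parcs G `` {w}) else if (w, u) \<in> parcs G then card (pverts G) - 1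
     else card (pverts G) - 2)"
  using assms pair_finite_verts by (auto simp: max_nbhd_def card_Diff_subset numeral_2_eq_2)

text \<open>Each neighbourhood lies in the finite set \<open>max_nbhd G w u\<close>, so equal sizes
  force equal sets, and neighbourhoods determine the arcs.\<close>

lemma eq_saturateI:
  assumes "\<And>u. u \<in> pverts G \<Longrightarrow> card (parcs G `` {u}) = card (max_nbhd G w u)"
  shows "saturate G w = G"
proof -
  have *: "parcs G `` {u} = max_nbhd G w u" if "u \<in> pverts G" for u
    using card_subset_eq[OF finite_max_nbhd nbhd_subset_max_nbhd assms[OF that]] .
  have "parcs (saturate G w) = Sigma (pverts G) (\<lambda>u. parcs G `` {u})"
    using * by (simp add: saturate_def cong: Sigma_cong)
  also have "\<dots> = parcs G"
    using arc_fst_in_verts by force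
  finally show ?thesis
    by simp
qed

text \<open>The three terms come from \<open>w\<close>, its neighbours and the remaining vertices.
  Only the order of \<open>G\<close> and the degree of \<open>w\<close> enter, so the formula
  compares graphs over different vertex types.\<close>

lemma degree_index_saturate:
  assumes "w \<in> pverts G"
  defines "d \<equiv> card (parcs G `` {w})"
  shows "degree_index h (saturate G w) =
    h d + real d * h (card (pverts G) - 1) + real (card (pverts G) - 1 - d) * h (card (pverts G) - 2)"
proof -
  let ?N = "parcs G `` {w}" and ?n = "card (pverts G)"
  have N: "?N \<subseteq> pverts G - {w}" "finite ?N"
    using nbhd_subset pair_finite_verts by (auto intro: finite_subset)
  have "degree_index h (saturate G w) = (\<Sum>u\<in>pverts G. h (card (max_nbhd G w u)))"
    by (simp add: degree_index_nbhd nbhd_saturate)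
  also have "\<dots> = h d + (\<Sum>u\<in>pverts G - {w}. h (card (max_nbhd G w u)))"
    using assms pair_finite_verts by (subst sum.remove[of _ w]) (auto simp: card_max_nbhd)
  also have "(\<Sum>u\<in>pverts G - {w}. h (card (max_nbhd G w u))) =
      (\<Sum>u\<in>?N. h (card (max_nbhd G w u))) + (\<Sum>u\<in>pverts G - {w} - ?N. h (card (max_nbhd G w u)))"
    using N pair_finite_verts by (subst sum.subset_diff[of ?N]) auto
  also have "(\<Sum>u\<in>?N. h (card (max_nbhd G w u))) = (\<Sum>u\<in>?N. h (?n - 1))"
    using assms N by (intro sum.cong) (auto simp: card_max_nbhd subset_iff)
  also have "(\<Sum>u\<in>pverts G - {w} - ?N. h (card (max_nbhd G w u))) =
      (\<Sum>u\<in>pverts G - {w} - ?N. h (?n - 2))"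
    using assms by (intro sum.cong) (auto simp: card_max_nbhd)
  finally show ?thesis
    using N assms pair_finite_verts by (simp add: card_Diff_subset)
qed

lemma card_nbhd_le: "card (parcs G `` {u}) \<le> card (max_nbhd G w u)"
  by (rule card_mono[OF finite_max_nbhd nbhd_subset_max_nbhd])

text \<open>The comparison is termwise; degrees of at least 1 keep it in the range where
  \<open>h\<close> is non-increasing.\<close>

lemma degree_index_saturate_le:
  assumes "antimono_on {1..} h" "\<And>u. u \<in> pverts G \<Longrightarrow> 1 \<le> card (parcs G `` {u})"
  shows "degree_index h (saturate G w) \<le> degree_index h G"
  unfolding degree_index_nbhd pverts_saturate
proof (rule sum_mono)
  fix u assume u: "u \<in> pverts G"
  with assms card_nbhd_le[of u w] show "h (card (parcs (saturate G w) `` {u})) \<le> h (card (parcs G `` {u}))"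
    by (force simp: nbhd_saturate intro: monotone_onD[OF assms(1)])
qed

text \<open>The equality case: every summand can only decrease, so an index that does not drop
  leaves each summand, and by strictness each degree, unchanged.\<close>

lemma saturate_eqI_degree_index:
  assumes anti: "antimono_on {1..} h"
    and pos: "\<And>u. u \<in> pverts G \<Longrightarrow> 1 \<le> card (parcs G `` {u})"
    and w: "w \<in> pverts G" and n: "card (pverts G) = \<Delta> + 1"
    and strict: "\<Delta> > 2 \<Longrightarrow> h (\<Delta> - 2) > h (\<Delta> - 1)" "h (\<Delta> - 1) > h \<Delta>"
    and le: "degree_index h G \<le> degree_index h (saturate G w)"
  shows "saturate G w = G"
proof (rule eq_saturateI)
  fix u assume u: "u \<in> pverts G"
  have mono: "h (card (max_nbhd G w v)) \<le> h (card (parcs G `` {v}))" if "v \<in> pverts G" for v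
    using pos[OF that] card_nbhd_le[of v w] by (intro monotone_onD[OF anti]) auto
  have "(\<Sum>v\<in>pverts G. h (card (parcs G `` {v})) - h (card (max_nbhd G w v))) \<le> 0"
    using le by (simp add: degree_index_nbhd nbhd_saturate sum_subtractf)
  with mono have "(\<Sum>v\<in>pverts G. h (card (parcs G `` {v})) - h (card (max_nbhd G w v))) = 0"
    by (intro antisym sum_nonneg) auto
  with mono u have eq: "h (card (parcs G `` {u})) = h (card (max_nbhd G w u))"
    using pair_finite_verts by (subst (asm) sum_nonneg_eq_0_iff) auto
  show "card (parcs G `` {u}) = card (max_nbhd G w u)"
  proof (rule ccontr)
    let ?k = "card (parcs G `` {u})" and ?m = "card (max_nbhd G w u)"
    assume "?k \<noteq> ?m"
    then have less: "?k < ?m"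
      using card_nbhd_le[of u w] by simp
    then have "u \<noteq> w"
      by (auto simp: max_nbhd_def)
    \<comment> \<open>A neighbour of \<open>w\<close> ends with degree \<Delta>, any other vertex
      different from \<open>w\<close> with \<Delta> - 1.\<close>
    then have m: "?m = \<Delta> \<or> ?m = \<Delta> - 1"
      using card_max_nbhd[OF w u] n by auto
    have k: "1 \<le> ?k"
      using pos[OF u] .
    \<comment> \<open>Since \<open>?k\<close> is at most \<open>?m - 1\<close>, a strict drop of
      \<open>h\<close> from \<open>?m - 1\<close> to \<open>?m\<close> contradicts
      \<open>eq\<close>.\<close>
    have "h ?k \<ge> h (?m - 1)"
      using less k by (intro monotone_onD[OF anti]) auto
    moreover have "h (?m - 1) > h ?m"
      using m
    proof
      assume "?m = \<Delta> - 1"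
      \<comment> \<open>The chain \<open>1 \<le> ?k < \<Delta> - 1\<close> meets the guard of the
        first strict inequality.\<close>
      moreover from this less k have "\<Delta> > 2"
        by simp
      ultimately show ?thesis
        using strict(1) by (simp add: numeral_2_eq_2)
    qed (use strict(2) in simp)
    ultimately show False
      using eq by simp
  qed
qed

text \<open>A neighbour of \<open>w\<close>, which exists since 1 \<le> \<delta>, attains the
  maximum; \<open>w\<close> attains the minimum since \<delta> \<le> \<Delta> - 1. This makes the
  saturation a competitor with the vertex type of \<open>G\<close>.\<close>

lemma saturate_in_graph_family:
  assumes w: "w \<in> pverts G" and d: "card (parcs G `` {w}) = \<delta>" and n: "card (pverts G) = \<Delta> + 1"
    and \<delta>: "1 \<le> \<delta>" "\<delta> < \<Delta>"
  shows "saturate G w \<in> graph_family (\<Delta> + 1) \<delta> \<Delta>"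
proof -
  let ?D = "out_degree (with_proj (saturate G w)) ` pverts G"
  have deg: "out_degree (with_proj (saturate G w)) u =
      (if u = w then \<delta> else if (w, u) \<in> parcs G then \<Delta> else \<Delta> - 1)" if "u \<in> pverts G" for u
    using that card_max_nbhd[OF w that] d n by (simp add: out_degree_with_proj nbhd_saturate)
  have fin: "finite ?D"
    by (simp add: pair_finite_verts)
  have "parcs G `` {w} \<noteq> {}"
    using d \<delta> by auto
  then obtain v where v: "v \<in> parcs G `` {w}"
    by blast
  then have "v \<in> pverts G" "v \<noteq> w"
    using nbhd_subset by blast+
  with v deg[of v] have "\<Delta> \<in> ?D"
    by force
  with fin have "Max ?D = \<Delta>"
    using deg \<delta> by (intro Max_eqI) auto
  moreover have "\<delta> \<in> ?D"
    using deg[OF w] w by force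
  with fin have "Min ?D = \<delta>"
    using deg \<delta> by (intro Min_eqI) auto
  ultimately show ?thesis
    using n pair_graph_saturate[OF w] by (simp add: graph_family_def)
qed

end

section \<open>Isomorphisms of saturated graphs\<close>

text \<open>Without parallel arcs, the vertex bijection induces the arc map, namely
  \<open>map_prod f f\<close>.\<close>

lemma digraph_iso_with_projI:
  assumes G: "pair_graph G" and H: "pair_graph H" and f: "bij_betw f (pverts G) (pverts H)"
    and arcs: "\<And>u v. u \<in> pverts G \<Longrightarrow> v \<in> pverts G \<Longrightarrow> (u, v) \<in> parcs G \<longleftrightarrow> (f u, f v) \<in> parcs H"
  shows "digraph_iso (with_proj G) (with_proj H)"
proof -
  interpret G: pair_graph G by fact
  let ?f = "\<lparr>iso_verts = f, iso_arcs = map_prod f f, iso_head = snd, iso_tail = fst\<rparr>"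
  have sub: "parcs G \<subseteq> pverts G \<times> pverts G" "parcs H \<subseteq> pverts H \<times> pverts H"
    using G H by (auto simp: pair_graph_iff)
  have inj: "inj_on f (pverts G)" and im: "f ` pverts G = pverts H"
    using f by (auto simp: bij_betw_def)
  have "inj_on (map_prod f f) (parcs G)"
    using inj_on_subset[OF map_prod_inj_on[OF inj inj] sub(1)] .
  then have "pre_digraph.digraph_isomorphism (with_proj G) ?f"
    using inj G.wf_digraph_axioms by (auto simp: pre_digraph.digraph_isomorphism_def)
  \<comment> \<open>The predicate \<open>digraph_isomorphism\<close> constrains the map on the
    source only; that the image is all of \<open>H\<close> is a separate claim.\<close>
  moreover have "map_prod f f ` parcs G = parcs H"
  proof
    show "map_prod f f ` parcs G \<subseteq> parcs H"
      using sub arcs by fastforce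
    show "parcs H \<subseteq> map_prod f f ` parcs G"
    proof
      fix e assume e: "e \<in> parcs H"
      then obtain u v where "e = (f u, f v)" "u \<in> pverts G" "v \<in> pverts G"
        using sub im by (cases e) blast
      with e arcs show "e \<in> map_prod f f ` parcs G"
        by force
    qed
  qed
  then have "with_proj H = app_iso ?f (with_proj G)"
    using im by (simp add: app_iso_def with_proj_def)
  ultimately show ?thesis
    unfolding digraph_iso_def by blast
qed

lemma degree_index_cong_digraph_iso:
  assumes "pair_graph G" "digraph_iso (with_proj G) (with_proj H)"
  shows "degree_index h G = degree_index h H"
proof -
  interpret pair_graph G by fact
  obtain f where f: "pre_digraph.digraph_isomorphism (with_proj G) f"
    and H: "with_proj H = app_iso f (with_proj G)"
    using assms(2) by (auto simp: digraph_iso_def)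
  have "pverts H = verts (app_iso f (with_proj G))"
    by (simp flip: H)
  then have "pverts H = iso_verts f ` pverts G"
    by simp
  moreover have "inj_on (iso_verts f) (pverts G)"
    using digraph_isomorphism_inj_on_verts[OF f] .
  ultimately show ?thesis
    unfolding degree_index_def H
    by (simp add: sum.reindex out_degree_app_iso_eq[OF f])
qed

text \<open>Order and degree of the chosen vertex determine a saturated graph up to isomorphism: any
  bijection sending \<open>w\<close> to \<open>x\<close> and neighbours of \<open>w\<close> onto
  those of \<open>x\<close> works.\<close>

lemma digraph_iso_saturate:
  assumes G: "pair_graph G" and H: "pair_graph H"
    and w: "w \<in> pverts G" and x: "x \<in> pverts H"
    and n: "card (pverts G) = card (pverts H)"
    and d: "card (parcs G `` {w}) = card (parcs H `` {x})"
  shows "digraph_iso (with_proj (saturate G w)) (with_proj (saturate H x))"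
proof -
  interpret G: pair_graph G by fact
  interpret H: pair_graph H by fact
  let ?N = "parcs G `` {w}" and ?M = "parcs H `` {x}"
  have N: "?N \<subseteq> pverts G - {w}" "finite ?N" and M: "?M \<subseteq> pverts H - {x}" "finite ?M"
    using G.nbhd_subset[of w] G.pair_finite_verts H.nbhd_subset[of x] H.pair_finite_verts
    by (auto intro: finite_subset)
  obtain g where g: "bij_betw g ?N ?M"
    using finite_same_card_bij[OF N(2) M(2) d] by blast
  have "card (pverts G - {w} - ?N) = card (pverts H - {x} - ?M)"
    using N M w x n d G.pair_finite_verts H.pair_finite_verts by (simp add: card_Diff_subset)
  then obtain k where k: "bij_betw k (pverts G - {w} - ?N) (pverts H - {x} - ?M)"
    using finite_same_card_bij G.pair_finite_verts H.pair_finite_verts by (metis finite_Diff)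
  define f where "f u = (if u = w then x else if u \<in> ?N then g u else k u)" for u
  have fN: "bij_betw f ?N ?M"
    using g N by (subst bij_betw_cong[of _ _ g]) (auto simp: f_def)
  have fR: "bij_betw f (pverts G - {w} - ?N) (pverts H - {x} - ?M)"
    using k by (subst bij_betw_cong[of _ _ k]) (auto simp: f_def)
  have "bij_betw f (?N \<union> (pverts G - {w} - ?N)) (?M \<union> (pverts H - {x} - ?M))"
    using fN fR by (rule bij_betw_combine) auto
  moreover have "bij_betw f {w} {x}"
    by (simp add: f_def)
  ultimately have "bij_betw f ((?N \<union> (pverts G - {w} - ?N)) \<union> {w}) ((?M \<union> (pverts H - {x} - ?M)) \<union> {x})"
    by (rule bij_betw_combine) (use M in auto)
  moreover have "(?N \<union> (pverts G - {w} - ?N)) \<union> {w} = pverts G" "(?M \<union> (pverts H - {x} - ?M)) \<union> {x} = pverts H"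
    using N M w x by auto
  ultimately have f: "bij_betw f (pverts G) (pverts H)"
    by simp
  have fw: "f w = x"
    by (simp add: f_def)
  have eq: "f u = f v \<longleftrightarrow> u = v" if "u \<in> pverts G" "v \<in> pverts G" for u v
    using f that by (auto simp: bij_betw_def dest: inj_onD)
  have inN: "(w, u) \<in> parcs G \<longleftrightarrow> (x, f u) \<in> parcs H" if "u \<in> pverts G" for u
  proof (cases "u \<in> ?N")
    case True
    with fN show ?thesis
      by (auto dest: bij_betwE)
  next
    case False
    show ?thesis
    proof (cases "u = w")
      case True
      then show ?thesis
        using N M fw by auto
    next
      case neq: False
      with False that bij_betwE[OF fR] have "f u \<in> pverts H - {x} - ?M"
        by blast
      with False show ?thesis
        by simp
    qed
  qed
  have fV: "f u \<in> pverts H" if "u \<in> pverts G" for u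
    using f that by (auto dest: bij_betwE)
  show ?thesis
  proof (rule digraph_iso_with_projI)
    show "pair_graph (saturate G w)" "pair_graph (saturate H x)"
      using G.pair_graph_saturate[OF w] H.pair_graph_saturate[OF x] .
    show "bij_betw f (pverts (saturate G w)) (pverts (saturate H x))"
      using f by simp
    show "(u, v) \<in> parcs (saturate G w) \<longleftrightarrow> (f u, f v) \<in> parcs (saturate H x)"
      if "u \<in> pverts (saturate G w)" "v \<in> pverts (saturate G w)" for u v
      \<comment> \<open>Adjacency after saturation depends only on whether \<open>u\<close> and
        \<open>v\<close> are equal, which of them is \<open>w\<close>, and which are adjacent to
        \<open>w\<close> in \<open>G\<close>; by \<open>eq\<close>, \<open>fw\<close> and
        \<open>inN\<close>, \<open>f\<close> respects all of this.\<close>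
      using that eq[of u v] eq[of u w] eq[of v w] inN[of u] inN[of v] w fV[of u] fV[of v] fw
      by (auto simp: saturate_def max_nbhd_def)
  qed
qed

section \<open>The extremal graph as a saturated graph\<close>

lemma card_pverts_H_graph: "card (pverts (H_graph \<delta> \<Delta>)) = \<Delta> + 1"
  by (simp add: H_graph_def)

lemma pair_graph_H_graph: "\<delta> \<le> \<Delta> \<Longrightarrow> pair_graph (H_graph \<delta> \<Delta>)"
  by (auto simp: pair_graph_iff H_graph_def sym_def irrefl_def)

lemma nbhd_H_graph_0: "parcs (H_graph \<delta> \<Delta>) `` {0} = {1..\<delta>}"
  by (auto simp: H_graph_def)

text \<open>The vertices other than \<open>0\<close> already form a complete graph. Through this
  fixed point, general facts on saturation apply to \<open>H_graph\<close>.\<close>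

lemma saturate_H_graph: "\<delta> \<le> \<Delta> \<Longrightarrow> saturate (H_graph \<delta> \<Delta>) 0 = H_graph \<delta> \<Delta>"
  by (auto simp: saturate_def max_nbhd_def H_graph_def split: if_splits)

lemma graph_familyE_min_vertex:
  assumes "G \<in> graph_family (\<Delta> + 1) \<delta> \<Delta>"
  obtains w where "w \<in> pverts G" "card (parcs G `` {w}) = \<delta>"
    "\<And>u. u \<in> pverts G \<Longrightarrow> \<delta> \<le> card (parcs G `` {u})"
proof -
  let ?D = "(\<lambda>u. card (parcs G `` {u})) ` pverts G"
  have Min: "Min ?D = \<delta>" and n: "card (pverts G) = \<Delta> + 1"
    using assms by (auto simp: graph_family_def out_degree_with_proj)
  \<comment> \<open>A positive cardinality makes the vertex set finite and nonempty, so the minimum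
    is attained.\<close>
  then have fin: "finite ?D" and ne: "?D \<noteq> {}"
    using card_ge_0_finite[of "pverts G"] by auto
  show thesis
    using that Min_in[OF fin ne] Min_le[OF fin] Min by auto
qed

text \<open>Both sides are indices of saturations with equal order and equal degree at the chosen
  vertex.\<close>

lemma degree_index_saturate_eq_H_graph:
  assumes "pair_graph G" "card (pverts G) = \<Delta> + 1" "w \<in> pverts G" "card (parcs G `` {w}) = \<delta>" "\<delta> \<le> \<Delta>"
  shows "degree_index h (saturate G w) = degree_index h (H_graph \<delta> \<Delta>)"
proof -
  have "degree_index h (saturate (H_graph \<delta> \<Delta>) 0) =
      h \<delta> + real \<delta> * h \<Delta> + real (\<Delta> - \<delta>) * h (\<Delta> - 1)"
    using assms(5) pair_graph.degree_index_saturate[OF pair_graph_H_graph, of \<delta> \<Delta> 0 h]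
    by (simp add: card_pverts_H_graph nbhd_H_graph_0) (simp add: H_graph_def)
  then show ?thesis
    using assms pair_graph.degree_index_saturate[OF assms(1,3), of h] by (simp add: saturate_H_graph)
qed

lemma H_graph_in_graph_family:
  assumes "1 \<le> \<delta>" "\<delta> < \<Delta>"
  shows "H_graph \<delta> \<Delta> \<in> graph_family (\<Delta> + 1) \<delta> \<Delta>"
proof -
  interpret pair_graph "H_graph \<delta> \<Delta>"
    using assms by (simp add: pair_graph_H_graph)
  have "0 \<in> pverts (H_graph \<delta> \<Delta>)"
    by (simp add: H_graph_def)
  from saturate_in_graph_family[OF this _ card_pverts_H_graph assms] show ?thesis
    using assms by (simp add: nbhd_H_graph_0 saturate_H_graph)
qed

section \<open>Minimality and uniqueness\<close>

text \<open>Saturation at a vertex of degree \<delta> links \<open>G\<close> to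
  \<open>H_graph\<close> even when their vertex types differ.\<close>

lemma degree_index_H_graph_le:
  assumes "1 \<le> \<delta>" "\<delta> < \<Delta>" "antimono_on {1..} h" "G \<in> graph_family (\<Delta> + 1) \<delta> \<Delta>"
  shows "degree_index h (H_graph \<delta> \<Delta>) \<le> degree_index h G"
proof -
  interpret pair_graph G
    using assms by (simp add: graph_family_def)
  obtain w where w: "w \<in> pverts G" "card (parcs G `` {w}) = \<delta>"
      "\<And>u. u \<in> pverts G \<Longrightarrow> \<delta> \<le> card (parcs G `` {u})"
    by (rule graph_familyE_min_vertex[OF assms(4)]) blast
  have "degree_index h (saturate G w) \<le> degree_index h G"
    using degree_index_saturate_le[OF assms(3)] w(3) assms(1) le_trans by blast
  moreover have "degree_index h (saturate G w) = degree_index h (H_graph \<delta> \<Delta>)"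
    using assms w degree_index_saturate_eq_H_graph[OF pair_graph_axioms]
    by (simp add: graph_family_def)
  ultimately show ?thesis
    by simp
qed

text \<open>Since \<open>minimal_on\<close> compares graphs of one vertex type, the bound over
  \<open>'a\<close> is a conjunct of its own. For \<Delta> = 2 the argument \<Delta> - 2 is not a
  positive integer, hence the guard.\<close>

theorem theorem2p10:
  fixes h :: "nat \<Rightarrow> real" and \<delta> \<Delta> :: nat
  assumes "1 \<le> \<delta>" and "\<delta> < \<Delta>"
    and "\<forall>k\<ge>1. h k > 0"
    and "antimono_on {1..} h"
  shows "minimal_on (degree_index h) (graph_family (\<Delta> + 1) \<delta> \<Delta>) (H_graph \<delta> \<Delta>) \<and>
    (\<forall>G \<in> (graph_family (\<Delta> + 1) \<delta> \<Delta> :: 'a pair_pre_digraph set).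
       degree_index h (H_graph \<delta> \<Delta>) \<le> degree_index h G) \<and>
    ((\<Delta> > 2 \<longrightarrow> h (\<Delta> - 2) > h (\<Delta> - 1)) \<and> h (\<Delta> - 1) > h \<Delta> \<longrightarrow>
      (\<forall>G \<in> (graph_family (\<Delta> + 1) \<delta> \<Delta> :: 'a pair_pre_digraph set).
         minimal_on (degree_index h) (graph_family (\<Delta> + 1) \<delta> \<Delta>) G \<longleftrightarrow>
         digraph_iso (with_proj G) (with_proj (H_graph \<delta> \<Delta>))))"
proof (intro conjI impI ballI)
  show "minimal_on (degree_index h) (graph_family (\<Delta> + 1) \<delta> \<Delta>) (H_graph \<delta> \<Delta>)"
    unfolding minimal_on_def using H_graph_in_graph_family[OF assms(1,2)]
    by (blast intro: degree_index_H_graph_le[OF assms(1,2,4)])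
  show "degree_index h (H_graph \<delta> \<Delta>) \<le> degree_index h G"
    if "G \<in> graph_family (\<Delta> + 1) \<delta> \<Delta>" for G :: "'a pair_pre_digraph"
    using degree_index_H_graph_le[OF assms(1,2,4) that] .
  fix G :: "'a pair_pre_digraph"
  assume strict: "(\<Delta> > 2 \<longrightarrow> h (\<Delta> - 2) > h (\<Delta> - 1)) \<and> h (\<Delta> - 1) > h \<Delta>"
    and G: "G \<in> graph_family (\<Delta> + 1) \<delta> \<Delta>"
  then interpret pair_graph G
    by (simp add: graph_family_def)
  have n: "card (pverts G) = \<Delta> + 1"
    using G by (simp add: graph_family_def)
  obtain w where w: "w \<in> pverts G" "card (parcs G `` {w}) = \<delta>"
      "\<And>u. u \<in> pverts G \<Longrightarrow> \<delta> \<le> card (parcs G `` {u})"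
    by (rule graph_familyE_min_vertex[OF G]) blast
  show "minimal_on (degree_index h) (graph_family (\<Delta> + 1) \<delta> \<Delta>) G \<longleftrightarrow>
      digraph_iso (with_proj G) (with_proj (H_graph \<delta> \<Delta>))"
  proof
    assume "minimal_on (degree_index h) (graph_family (\<Delta> + 1) \<delta> \<Delta>) G"
    \<comment> \<open>With vertices in \<open>nat\<close>, \<open>H_graph\<close> need not be a
      competitor of \<open>G\<close>; the saturation of \<open>G\<close> takes its place.\<close>
    then have "degree_index h G \<le> degree_index h (saturate G w)"
      using saturate_in_graph_family[OF w(1,2) n assms(1,2)] by (simp add: minimal_on_def)
    moreover have "1 \<le> card (parcs G `` {u})" if "u \<in> pverts G" for u
      using assms(1) w(3)[OF that] by simp
    ultimately have "saturate G w = G"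
      using strict by (intro saturate_eqI_degree_index[OF assms(4) _ w(1) n]) auto
    \<comment> \<open>Both graphs equal their own saturations, so an isomorphism of the saturations
      suffices.\<close>
    moreover have "digraph_iso (with_proj (saturate G w)) (with_proj (saturate (H_graph \<delta> \<Delta>) 0))"
    proof (rule digraph_iso_saturate)
      show "0 \<in> pverts (H_graph \<delta> \<Delta>)"
        by (simp add: H_graph_def)
    qed (use assms(2) w n pair_graph_axioms in
        \<open>simp_all add: pair_graph_H_graph card_pverts_H_graph nbhd_H_graph_0\<close>)
    ultimately show "digraph_iso (with_proj G) (with_proj (H_graph \<delta> \<Delta>))"
      using assms(2) by (simp add: saturate_H_graph)
  next
    assume "digraph_iso (with_proj G) (with_proj (H_graph \<delta> \<Delta>))"
    then have "degree_index h G = degree_index h (H_graph \<delta> \<Delta>)"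
      by (rule degree_index_cong_digraph_iso[OF pair_graph_axioms])
    then show "minimal_on (degree_index h) (graph_family (\<Delta> + 1) \<delta> \<Delta>) G"
      unfolding minimal_on_def using G by (metis degree_index_H_graph_le[OF assms(1,2,4)])
  qed
qed

end
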